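(* Let $p$ be a prime, $D=\{0,1,\dots,p-1\}$, and $f(x,y,z)=x-y+z \pmod p$. Then for any set of relations $\Gamma$ over $D$ with $\langle\Gamma\rangle\subseteq\mathrm{Inv}(f)$, the co-clone $\langle\Gamma\rangle$ is $\exists!$-covered.
   Context: Relations over $D$ are subsets of $D^n$; $\mathrm{Eq}_D=\{(d,d)\mid d\in D\}$. An operation $g\colon D^k\to D$ preserves an $n$-ary relation $R$ if applying $g$ coordinatewise to any $k$ tuples of $R$ gives a tuple of $R$; $\mathrm{Inv}(f)$ is the set of relations preserved by $f$. A pp-definition of an $n$-ary relation $R$ over $\Gamma$ is a formula $R(x_1,\dots,x_n)\equiv\exists y_1,\dots,y_m\colon R_1(\mathbf{x}_1)\wedge\dots\wedge R_k(\mathbf{x}_k)$ with $R_j\in\Gamma\cup\{\mathrm{Eq}_D\}$ and each $\mathbf{x}_j$ a tuple of variables among $x_1,\dots,x_n,y_1,\dots,y_m$; $\langle\Gamma\rangle$ is the set of pp-definable relations (a co-clone); $\Delta$ is a base of a co-clone $C$ if $\langle\Delta\rangle=C$. A upp-definition is a pp-definition in which each $y_j$ is uniquely determined by $x_1,\dots,x_n$ (there is $h_j\colon D^n\to D$ such that every satisfying assignment of the conjunction gives $y_j$ the value $h_j$ of the values of $x_1,\dots,x_n$); $\langle\Delta\rangle_{\exists!}$ is the set of upp-definable relations. A co-clone $C$ is $\exists!$-covered if $\langle\Delta\rangle_{\exists!}=C$ for every base $\Delta$ of $C$. *)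

theory Defs
  imports "HOL-Library.NList" "HOL-Library.FuncSet" "HOL-Computational_Algebra.Primes"
begin

text \<open>
  The set \<open>D\<^sup>n\<close> is \<^term>\<open>nlists n D\<close>. An \<open>n\<close>-ary relation \<open>R \<subseteq> D\<^sup>n\<close> is the pair \<open>(n, R)\<close>, so that
  empty relations of different arities are distinguished. Arity \<open>0\<close> is allowed.
\<close>

type_synonym 'a nrel = "nat \<times> 'a list set"

definition relations :: "'a set \<Rightarrow> 'a nrel set" where
  "relations D = {(n, R). R \<subseteq> nlists n D}"

definition Eq_rel :: "'a set \<Rightarrow> 'a nrel" where
  "Eq_rel D = (2, {[d, d] | d. d \<in> D})"

text \<open>A \<open>k\<close>-ary operation on \<open>D\<close> is a function on lists, of which only the values on
  \<^term>\<open>nlists k D\<close> matter.\<close>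

definition preserves :: "nat \<Rightarrow> ('a list \<Rightarrow> 'a) \<Rightarrow> 'a nrel \<Rightarrow> bool" where
  "preserves k g r \<longleftrightarrow>
     (\<forall>ts \<in> nlists k (snd r). map (\<lambda>i. g (map (\<lambda>t. t ! i) ts)) [0..<fst r] \<in> snd r)"

definition Inv :: "'a set \<Rightarrow> nat \<Rightarrow> ('a list \<Rightarrow> 'a) \<Rightarrow> 'a nrel set" where
  "Inv D k g = {r \<in> relations D. preserves k g r}"

text \<open>
  An atom \<open>R(z\<^sub>1, \<dots>, z\<^sub>l)\<close> is a relation together with a list of variables; a conjunction is a
  (possibly empty) list of atoms. Variables are numbered: in a formula with free variables
  \<open>x\<^sub>1, \<dots>, x\<^sub>n\<close> and quantified variables \<open>y\<^sub>1, \<dots>, y\<^sub>m\<close>, the indices below \<open>n\<close> stand for the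
  former and the indices \<open>n, \<dots>, n + m - 1\<close> for the latter.
\<close>

type_synonym 'a atom = "'a nrel \<times> nat list"

definition conj_over :: "'a set \<Rightarrow> 'a nrel set \<Rightarrow> nat \<Rightarrow> 'a atom list \<Rightarrow> bool" where
  "conj_over D \<Gamma> N \<phi> \<longleftrightarrow>
     (\<forall>(r, vs) \<in> set \<phi>. r \<in> \<Gamma> \<union> {Eq_rel D} \<and> length vs = fst r \<and> set vs \<subseteq> {..<N})"

definition satisfies :: "'a list \<Rightarrow> 'a atom list \<Rightarrow> bool" where
  "satisfies s \<phi> \<longleftrightarrow> (\<forall>(r, vs) \<in> set \<phi>. map (\<lambda>v. s ! v) vs \<in> snd r)"

definition pp_definition :: "'a set \<Rightarrow> 'a nrel set \<Rightarrow> 'a nrel \<Rightarrow> nat \<Rightarrow> 'a atom list \<Rightarrow> bool" where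
  "pp_definition D \<Gamma> r m \<phi> \<longleftrightarrow>
     conj_over D \<Gamma> (fst r + m) \<phi> \<and>
     snd r = {xs \<in> nlists (fst r) D. \<exists>ys \<in> nlists m D. satisfies (xs @ ys) \<phi>}"

definition upp_definition :: "'a set \<Rightarrow> 'a nrel set \<Rightarrow> 'a nrel \<Rightarrow> nat \<Rightarrow> 'a atom list \<Rightarrow> bool" where
  "upp_definition D \<Gamma> r m \<phi> \<longleftrightarrow>
     pp_definition D \<Gamma> r m \<phi> \<and>
     (\<forall>j < m. \<exists>h \<in> nlists (fst r) D \<rightarrow> D.
        \<forall>xs \<in> nlists (fst r) D. \<forall>ys \<in> nlists m D. satisfies (xs @ ys) \<phi> \<longrightarrow> ys ! j = h xs)"

definition pp_closure :: "'a set \<Rightarrow> 'a nrel set \<Rightarrow> 'a nrel set" where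
  "pp_closure D \<Gamma> = {r. \<exists>m \<phi>. pp_definition D \<Gamma> r m \<phi>}"

definition upp_closure :: "'a set \<Rightarrow> 'a nrel set \<Rightarrow> 'a nrel set" where
  "upp_closure D \<Gamma> = {r. \<exists>m \<phi>. upp_definition D \<Gamma> r m \<phi>}"

definition is_base :: "'a set \<Rightarrow> 'a nrel set \<Rightarrow> 'a nrel set \<Rightarrow> bool" where
  "is_base D \<Delta> C \<longleftrightarrow> \<Delta> \<subseteq> relations D \<and> pp_closure D \<Delta> = C"

definition co_clone :: "'a set \<Rightarrow> 'a nrel set \<Rightarrow> bool" where
  "co_clone D C \<longleftrightarrow> (\<exists>\<Gamma> \<subseteq> relations D. C = pp_closure D \<Gamma>)"

definition uniquely_covered :: "'a set \<Rightarrow> 'a nrel set \<Rightarrow> bool" where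
  "uniquely_covered D C \<longleftrightarrow> co_clone D C \<and> (\<forall>\<Delta>. is_base D \<Delta> C \<longrightarrow> upp_closure D \<Delta> = C)"

definition affine_op :: "nat \<Rightarrow> nat list \<Rightarrow> nat" where
  "affine_op p t = nat ((int (t ! 0) - int (t ! 1) + int (t ! 2)) mod int p)"

end

theory Submission
  imports Defs "HOL-Number_Theory.Cong"
begin

text \<open>
  The solution set of a conjunction over a base is closed under \<open>x - y + z\<close>, so adding multiples of
  the difference of two solutions that agree on the free variables to a third solution gives
  solutions again, with the same values of the free variables.
  Since \<open>p\<close> is prime, an existential variable that is not determined by the free variables
  therefore takes every value of \<open>D\<close> above every tuple of the defined relation. Hence requiring it
  to equal \<open>x\<^sub>1\<close> does not change that relation, and doing this for all undetermined variables
  yields a upp-definition. A nonempty relation of arity \<open>0\<close>, where there is no \<open>x\<^sub>1\<close>, is defined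
  by the empty conjunction.
\<close>

(* As simp rules these have extra variables in their premises, on which automation diverges. *)
declare nlistsE_length [simp del] nlistsE_set [simp del]

subsection \<open>Conjunctions and their solution sets\<close>

definition solutions :: "'a set \<Rightarrow> nat \<Rightarrow> 'a atom list \<Rightarrow> 'a list set" where
  "solutions D N \<phi> = {s \<in> nlists N D. satisfies s \<phi>}"

lemma solutions_Cons_Eq_rel:
  assumes "i < N" "j < N"
  shows "solutions D N ((Eq_rel D, [i, j]) # \<phi>) = {s \<in> solutions D N \<phi>. s ! i = s ! j}"
  using assms by (auto simp: solutions_def satisfies_def Eq_rel_def nlistsE_nth_in)

lemma pp_definition_iff_projection:
  "pp_definition D \<Gamma> r m \<phi> \<longleftrightarrow>
     conj_over D \<Gamma> (fst r + m) \<phi> \<and> snd r = take (fst r) ` solutions D (fst r + m) \<phi>"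
proof -
  define n where "n = fst r"
  have "{xs \<in> nlists n D. \<exists>ys \<in> nlists m D. satisfies (xs @ ys) \<phi>}
      = take n ` solutions D (n + m) \<phi>"
  proof (intro equalityI subsetI)
    fix xs assume "xs \<in> {xs \<in> nlists n D. \<exists>ys \<in> nlists m D. satisfies (xs @ ys) \<phi>}"
    then obtain ys where "xs \<in> nlists n D" "ys \<in> nlists m D" "satisfies (xs @ ys) \<phi>"
      by blast
    then have "xs @ ys \<in> solutions D (n + m) \<phi>" "xs = take n (xs @ ys)"
      by (auto simp: solutions_def nlists_def)
    then show "xs \<in> take n ` solutions D (n + m) \<phi>" by (rule rev_image_eqI)
  next
    fix xs assume "xs \<in> take n ` solutions D (n + m) \<phi>"
    then obtain s where s: "s \<in> nlists (n + m) D" "satisfies s \<phi>" "xs = take n s"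
      by (auto simp: solutions_def)
    then have "xs \<in> nlists n D" "drop n s \<in> nlists m D" "satisfies (xs @ drop n s) \<phi>"
      by (auto simp: nlists_def dest: in_set_takeD in_set_dropD)
    then show "xs \<in> {xs \<in> nlists n D. \<exists>ys \<in> nlists m D. satisfies (xs @ ys) \<phi>}" by blast
  qed
  then show ?thesis by (simp add: pp_definition_def n_def)
qed

lemma subset_pp_closure:
  assumes "\<Delta> \<subseteq> relations D"
  shows "\<Delta> \<subseteq> pp_closure D \<Delta>"
proof
  fix r assume r: "r \<in> \<Delta>"
  then have sub: "snd r \<subseteq> nlists (fst r) D" using assms by (cases r) (auto simp: relations_def)
  have "map ((!) xs) [0..<fst r] = xs" if "xs \<in> nlists (fst r) D" for xs
    using that map_nth[of xs] by (simp add: nlists_def)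
  then have "pp_definition D \<Delta> r 0 [(r, [0..<fst r])]"
    using r sub by (auto simp: pp_definition_def conj_over_def satisfies_def)
  then show "r \<in> pp_closure D \<Delta>" by (auto simp: pp_closure_def)
qed

subsection \<open>Solution sets are invariant relations\<close>

definition coordinatewise :: "nat \<Rightarrow> ('a list \<Rightarrow> 'a) \<Rightarrow> 'a list list \<Rightarrow> 'a list" where
  "coordinatewise n g ts = map (\<lambda>i. g (map (\<lambda>t. t ! i) ts)) [0..<n]"

lemma preserves_iff_coordinatewise:
  "preserves k g (n, R) \<longleftrightarrow> (\<forall>ts \<in> nlists k R. coordinatewise n g ts \<in> R)"
  by (simp add: preserves_def coordinatewise_def)

lemma coordinatewise_in_nlists:
  assumes "g \<in> nlists k D \<rightarrow> D" "ts \<in> nlists k (nlists n D)"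
  shows "coordinatewise n g ts \<in> nlists n D"
proof -
  have "map (\<lambda>t. t ! i) ts \<in> nlists k D" if "i < n" for i
    using assms(2) that nlistsE_nth_in by (fastforce simp: nlists_def)
  then have "g (map (\<lambda>t. t ! i) ts) \<in> D" if "i < n" for i
    using assms(1) that by blast
  then show ?thesis by (auto simp: coordinatewise_def nlists_def)
qed

lemma coordinatewise_select:
  assumes "set vs \<subseteq> {..<N}"
  shows "coordinatewise (length vs) g (map (\<lambda>s. map ((!) s) vs) ss)
    = map ((!) (coordinatewise N g ss)) vs"
proof (rule nth_equalityI)
  fix i assume "i < length (coordinatewise (length vs) g (map (\<lambda>s. map ((!) s) vs) ss))"
  then have "i < length vs" by (simp add: coordinatewise_def)
  moreover from this have "vs ! i < N" using assms nth_mem by fastforce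
  ultimately show "coordinatewise (length vs) g (map (\<lambda>s. map ((!) s) vs) ss) ! i
      = map ((!) (coordinatewise N g ss)) vs ! i"
    by (simp add: coordinatewise_def comp_def)
qed (simp add: coordinatewise_def)

lemma Eq_rel_in_Inv:
  assumes "g \<in> nlists k D \<rightarrow> D"
  shows "Eq_rel D \<in> Inv D k g"
proof -
  have "coordinatewise 2 g ts \<in> {[d, d] | d. d \<in> D}"
    if ts: "ts \<in> nlists k {[d, d] | d. d \<in> D}" for ts
  proof -
    have "map (\<lambda>t. t ! Suc 0) ts = map (\<lambda>t. t ! 0) ts" "map (\<lambda>t. t ! 0) ts \<in> nlists k D"
      using ts by (auto simp: nlists_def)
    then have "coordinatewise 2 g ts = [g (map (\<lambda>t. t ! 0) ts), g (map (\<lambda>t. t ! 0) ts)]"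
      and "g (map (\<lambda>t. t ! 0) ts) \<in> D"
      using assms by (auto simp: coordinatewise_def numeral_2_eq_2 simp del: map_eq_conv)
    then show ?thesis by simp
  qed
  then show ?thesis
    by (auto simp: Inv_def Eq_rel_def relations_def nlists_def preserves_iff_coordinatewise)
qed

lemma satisfies_coordinatewise:
  assumes g: "g \<in> nlists k D \<rightarrow> D" and \<Delta>: "\<Delta> \<subseteq> Inv D k g"
    and \<phi>: "conj_over D \<Delta> N \<phi>" and ss: "ss \<in> nlists k {s. satisfies s \<phi>}"
  shows "satisfies (coordinatewise N g ss) \<phi>"
  unfolding satisfies_def
proof clarify
  fix n R vs assume atom: "((n, R), vs) \<in> set \<phi>"
  have vs: "length vs = n" "set vs \<subseteq> {..<N}" and "(n, R) \<in> \<Delta> \<union> {Eq_rel D}"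
    using bspec[OF \<phi>[unfolded conj_over_def] atom] by auto
  then have "preserves k g (n, R)"
    using \<Delta> Eq_rel_in_Inv[OF g] by (auto simp: Inv_def)
  moreover have "map (\<lambda>s. map ((!) s) vs) ss \<in> nlists k R"
    using ss atom by (fastforce simp: nlists_def satisfies_def)
  ultimately have "coordinatewise n g (map (\<lambda>s. map ((!) s) vs) ss) \<in> R"
    by (simp add: preserves_iff_coordinatewise)
  then show "map ((!) (coordinatewise N g ss)) vs \<in> snd (n, R)"
    using coordinatewise_select[OF vs(2), of g ss] vs(1) by simp
qed

lemma solutions_in_Inv:
  assumes "g \<in> nlists k D \<rightarrow> D" "\<Delta> \<subseteq> Inv D k g" "conj_over D \<Delta> N \<phi>"
  shows "(N, solutions D N \<phi>) \<in> Inv D k g"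
proof -
  have "coordinatewise N g ss \<in> solutions D N \<phi>" if "ss \<in> nlists k (solutions D N \<phi>)" for ss
  proof -
    have "ss \<in> nlists k (nlists N D)" "ss \<in> nlists k {s. satisfies s \<phi>}"
      using that by (auto simp: solutions_def nlists_def)
    then show ?thesis
      using coordinatewise_in_nlists satisfies_coordinatewise assms
      by (fastforce simp: solutions_def)
  qed
  then show ?thesis
    by (auto simp: Inv_def relations_def solutions_def preserves_iff_coordinatewise)
qed

subsection \<open>Determined and unconstrained coordinates\<close>

definition determined :: "nat \<Rightarrow> 'a list set \<Rightarrow> nat \<Rightarrow> bool" where
  "determined n S j \<longleftrightarrow> (\<forall>s \<in> S. \<forall>t \<in> S. take n s = take n t \<longrightarrow> s ! j = t ! j)"

definition unconstrained :: "'a set \<Rightarrow> nat \<Rightarrow> 'a list set \<Rightarrow> nat \<Rightarrow> bool" where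
  "unconstrained D n S j \<longleftrightarrow> (\<forall>s \<in> S. \<forall>d \<in> D. \<exists>t \<in> S. take n t = take n s \<and> t ! j = d)"

lemma determined_subset: "determined n S j \<Longrightarrow> T \<subseteq> S \<Longrightarrow> determined n T j"
  unfolding determined_def by blast

lemma determined_equal_coordinate:
  assumes "i < n"
  shows "determined n {s \<in> S. s ! i = s ! j} j"
  using assms unfolding determined_def by (metis (mono_tags, lifting) mem_Collect_eq nth_take)

lemma take_image_unconstrained:
  assumes S: "S \<subseteq> nlists N D" and "i < n" "n \<le> N" and j: "unconstrained D n S j"
  shows "take n ` {s \<in> S. s ! i = s ! j} = take n ` S"
proof (intro equalityI subsetI)
  fix xs assume "xs \<in> take n ` S"
  then obtain s where s: "s \<in> S" "xs = take n s" by blast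
  have "s ! i \<in> D" using s S assms nlistsE_nth_in[of s N D i] by auto
  then obtain t where t: "t \<in> S" "take n t = take n s" "t ! j = s ! i"
    using j s unfolding unconstrained_def by blast
  then have "t ! i = t ! j" using \<open>i < n\<close> by (metis nth_take)
  with t s show "xs \<in> take n ` {s \<in> S. s ! i = s ! j}" by (intro rev_image_eqI[of t]) auto
qed blast

lemma determined_imp_function:
  assumes S: "S \<subseteq> nlists N D" and "D \<noteq> {}" "j < N" and j: "determined n S j"
  obtains h where "h \<in> nlists n D \<rightarrow> D" and "\<And>s. s \<in> S \<Longrightarrow> s ! j = h (take n s)"
proof -
  obtain d where "d \<in> D" using \<open>D \<noteq> {}\<close> by blast
  define h where "h xs = (if xs \<in> take n ` S then inv_into S (take n) xs ! j else d)" for xs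
  have "h xs \<in> D" for xs
  proof (cases "xs \<in> take n ` S")
    case True
    then have "inv_into S (take n) xs \<in> nlists N D" by (rule subsetD[OF S inv_into_into])
    then show ?thesis using True nlistsE_nth_in[OF _ \<open>j < N\<close>] by (simp add: h_def)
  qed (simp add: h_def \<open>d \<in> D\<close>)
  moreover have "s ! j = h (take n s)" if "s \<in> S" for s
  proof -
    have in_image: "take n s \<in> take n ` S" using that by (rule imageI)
    have "s ! j = inv_into S (take n) (take n s) ! j"
      using j[unfolded determined_def, rule_format, OF that inv_into_into[OF in_image]]
        f_inv_into_f[OF in_image] by simp
    then show ?thesis using in_image by (simp add: h_def)
  qed
  ultimately show ?thesis using that[of h] by blast
qed

lemma upp_definition_if_determined:
  assumes pp: "pp_definition D \<Delta> r m \<phi>" and "D \<noteq> {}"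
    and det: "\<And>j. j < fst r + m \<Longrightarrow> determined (fst r) (solutions D (fst r + m) \<phi>) j"
  shows "upp_definition D \<Delta> r m \<phi>"
  unfolding upp_definition_def
proof (intro conjI allI impI pp)
  fix j assume "j < m"
  define n where "n = fst r"
  define S where "S = solutions D (n + m) \<phi>"
  have "S \<subseteq> nlists (n + m) D" by (auto simp: S_def solutions_def)
  moreover have "determined n S (n + j)" using det \<open>j < m\<close> by (simp add: n_def S_def)
  ultimately obtain h where h: "h \<in> nlists n D \<rightarrow> D"
    and hS: "\<And>s. s \<in> S \<Longrightarrow> s ! (n + j) = h (take n s)"
    using determined_imp_function[of S "n + m" D "n + j" n] \<open>D \<noteq> {}\<close> \<open>j < m\<close> by auto
  have "ys ! j = h xs"
    if "xs \<in> nlists n D" "ys \<in> nlists m D" "satisfies (xs @ ys) \<phi>" for xs ys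
  proof -
    have "xs @ ys \<in> S" "length xs = n"
      using that by (auto simp: S_def solutions_def nlists_def)
    then show ?thesis using hS[of "xs @ ys"] by (simp add: nth_append)
  qed
  then show "\<exists>h \<in> nlists (fst r) D \<rightarrow> D. \<forall>xs \<in> nlists (fst r) D. \<forall>ys \<in> nlists m D.
      satisfies (xs @ ys) \<phi> \<longrightarrow> ys ! j = h xs"
    using h unfolding n_def by blast
qed

definition coordinate_dichotomy :: "'a set \<Rightarrow> 'a nrel set \<Rightarrow> bool" where
  "coordinate_dichotomy D \<Delta> \<longleftrightarrow>
     (\<forall>N \<phi> n j. conj_over D \<Delta> N \<phi> \<longrightarrow> j < N \<longrightarrow>
        determined n (solutions D N \<phi>) j \<or> unconstrained D n (solutions D N \<phi>) j)"

lemma pp_definition_determine_coordinate: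
  assumes dich: "coordinate_dichotomy D \<Delta>" and pp: "pp_definition D \<Delta> r m \<phi>"
    and "0 < fst r" and j: "j < fst r + m"
  obtains \<psi> where "pp_definition D \<Delta> r m \<psi>"
    and "solutions D (fst r + m) \<psi> \<subseteq> solutions D (fst r + m) \<phi>"
    and "determined (fst r) (solutions D (fst r + m) \<psi>) j"
proof -
  define n where "n = fst r"
  define S where "S = solutions D (n + m) \<phi>"
  have \<phi>: "conj_over D \<Delta> (n + m) \<phi>" and r: "snd r = take n ` S"
    using pp by (simp_all add: pp_definition_iff_projection n_def S_def)
  have "0 < n" "j < n + m" using \<open>0 < fst r\<close> j by (simp_all add: n_def)
  consider (determined) "determined n S j" | (unconstrained) "unconstrained D n S j"
    using dich \<phi> \<open>j < n + m\<close> unfolding coordinate_dichotomy_def S_def by blast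
  then show ?thesis
  proof cases
    case determined
    then show ?thesis using that[of \<phi>] pp by (simp add: n_def S_def)
  next
    case unconstrained
    let ?\<psi> = "(Eq_rel D, [0, j]) # \<phi>"
    have \<psi>: "solutions D (n + m) ?\<psi> = {s \<in> S. s ! 0 = s ! j}"
      using solutions_Cons_Eq_rel[of 0 "n + m" j] \<open>0 < n\<close> \<open>j < n + m\<close> by (simp add: S_def)
    have "conj_over D \<Delta> (n + m) ?\<psi>"
      using \<phi> \<open>0 < n\<close> \<open>j < n + m\<close> by (simp add: conj_over_def Eq_rel_def)
    moreover have "snd r = take n ` {s \<in> S. s ! 0 = s ! j}"
      using r take_image_unconstrained[OF _ \<open>0 < n\<close> _ unconstrained, of "n + m"]
      by (auto simp: S_def solutions_def)
    ultimately have "pp_definition D \<Delta> r m ?\<psi>"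
      using \<psi> by (simp add: pp_definition_iff_projection n_def)
    then show ?thesis
      using that[of ?\<psi>] \<psi> determined_equal_coordinate[OF \<open>0 < n\<close>] by (auto simp: n_def S_def)
  qed
qed

lemma pp_definition_determine_coordinates:
  assumes dich: "coordinate_dichotomy D \<Delta>" and pp: "pp_definition D \<Delta> r m \<phi>"
    and "0 < fst r" and "k \<le> fst r + m"
  shows "\<exists>\<psi>. pp_definition D \<Delta> r m \<psi> \<and>
    (\<forall>j < k. determined (fst r) (solutions D (fst r + m) \<psi>) j)"
  using \<open>k \<le> fst r + m\<close>
proof (induction k)
  case 0
  then show ?case using pp by auto
next
  case (Suc k)
  then obtain \<psi> where pp\<psi>: "pp_definition D \<Delta> r m \<psi>"
    and det\<psi>: "\<forall>j < k. determined (fst r) (solutions D (fst r + m) \<psi>) j" by auto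
  obtain \<chi> where "pp_definition D \<Delta> r m \<chi>"
    and "solutions D (fst r + m) \<chi> \<subseteq> solutions D (fst r + m) \<psi>"
    and "determined (fst r) (solutions D (fst r + m) \<chi>) k"
    using pp_definition_determine_coordinate[OF dich pp\<psi> \<open>0 < fst r\<close>] Suc.prems
    by (metis Suc_le_lessD)
  then show ?case using det\<psi> determined_subset by (metis less_Suc_eq)
qed

lemma nullary_pp_definition_determined:
  assumes pp: "pp_definition D \<Delta> r m \<phi>" and "fst r = 0"
  shows "\<exists>m' \<psi>. pp_definition D \<Delta> r m' \<psi> \<and>
    (\<forall>j < fst r + m'. determined (fst r) (solutions D (fst r + m') \<psi>) j)"
proof (cases "snd r = {}")
  case True
  then have "solutions D (fst r + m) \<phi> = {}" using pp by (simp add: pp_definition_iff_projection)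
  then have "determined (fst r) (solutions D (fst r + m) \<phi>) j" for j by (simp add: determined_def)
  then show ?thesis using pp by blast
next
  case False
  then have "snd r = {[]}" using pp \<open>fst r = 0\<close> by (auto simp: pp_definition_def)
  then have "pp_definition D \<Delta> r 0 []"
    using \<open>fst r = 0\<close> by (simp add: pp_definition_def conj_over_def satisfies_def)
  then show ?thesis using \<open>fst r = 0\<close> by force
qed

lemma upp_closure_eq_pp_closure:
  assumes "D \<noteq> {}" and dich: "coordinate_dichotomy D \<Delta>"
  shows "upp_closure D \<Delta> = pp_closure D \<Delta>"
proof
  show "upp_closure D \<Delta> \<subseteq> pp_closure D \<Delta>"
    by (auto simp: upp_closure_def pp_closure_def upp_definition_def)
  show "pp_closure D \<Delta> \<subseteq> upp_closure D \<Delta>"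
  proof
    fix r assume "r \<in> pp_closure D \<Delta>"
    then obtain m \<phi> where pp: "pp_definition D \<Delta> r m \<phi>" by (auto simp: pp_closure_def)
    have "\<exists>m \<psi>. pp_definition D \<Delta> r m \<psi> \<and>
        (\<forall>j < fst r + m. determined (fst r) (solutions D (fst r + m) \<psi>) j)"
      using pp_definition_determine_coordinates[OF dich pp _ order_refl]
        nullary_pp_definition_determined[OF pp] by blast
    then show "r \<in> upp_closure D \<Delta>"
      using upp_definition_if_determined[OF _ \<open>D \<noteq> {}\<close>] unfolding upp_closure_def by blast
  qed
qed

subsection \<open>Relations invariant under the affine operation\<close>

definition translate :: "nat \<Rightarrow> nat \<Rightarrow> nat list \<Rightarrow> nat list \<Rightarrow> nat list \<Rightarrow> nat list" where
  "translate p k a b s =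
     map (\<lambda>i. nat ((int (s ! i) + int k * (int (b ! i) - int (a ! i))) mod int p)) [0..<length s]"

lemma length_translate [simp]: "length (translate p k a b s) = length s"
  by (simp add: translate_def)

lemma int_nth_translate:
  assumes "0 < p" "i < length s"
  shows "int (translate p k a b s ! i)
    = (int (s ! i) + int k * (int (b ! i) - int (a ! i))) mod int p"
  using assms by (simp add: translate_def)

lemma nth_translate_equal:
  assumes "i < length s" "s ! i < p" "a ! i = b ! i"
  shows "translate p k a b s ! i = s ! i"
  using assms by (simp add: translate_def)

lemma translate_0: "s \<in> nlists N {0..<p} \<Longrightarrow> translate p 0 a b s = s"
  using nlistsE_nth_in[of s N "{0..<p}"]
  by (auto intro!: nth_equalityI simp: translate_def nlists_def)

lemma coordinatewise_affine_op_translate: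
  assumes "0 < p"
  shows "coordinatewise (length s) (affine_op p) [translate p k a b s, a, b]
    = translate p (Suc k) a b s"
proof (rule nth_equalityI)
  fix i assume "i < length (coordinatewise (length s) (affine_op p) [translate p k a b s, a, b])"
  then have i: "i < length s" by (simp add: coordinatewise_def)
  define d where "d = int (b ! i) - int (a ! i)"
  have "((int (s ! i) + int k * d) mod int p - int (a ! i) + int (b ! i)) mod int p
      = ((int (s ! i) + int k * d) mod int p + d) mod int p"
    by (simp add: d_def algebra_simps)
  also have "\<dots> = (int (s ! i) + int k * d + d) mod int p"
    by (rule mod_add_left_eq)
  also have "int (s ! i) + int k * d + d = int (s ! i) + int (Suc k) * d"
    by (simp add: algebra_simps)
  finally show "coordinatewise (length s) (affine_op p) [translate p k a b s, a, b] ! i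
      = translate p (Suc k) a b s ! i"
    using i assms
    by (simp add: coordinatewise_def affine_op_def int_nth_translate)
       (simp add: translate_def d_def)
qed (simp add: coordinatewise_def)

lemma translate_in_affine_relation:
  assumes "0 < p" and inv: "(N, S) \<in> Inv {0..<p} 3 (affine_op p)"
    and "a \<in> S" "b \<in> S" "s \<in> S"
  shows "translate p k a b s \<in> S"
proof -
  have s: "s \<in> nlists N {0..<p}" using inv \<open>s \<in> S\<close> by (auto simp: Inv_def relations_def)
  show ?thesis
  proof (induction k)
    case 0
    show ?case using translate_0[OF s] \<open>s \<in> S\<close> by simp
  next
    case (Suc k)
    then have "[translate p k a b s, a, b] \<in> nlists 3 S"
      using assms by (simp add: nlists_def)
    then have "coordinatewise N (affine_op p) [translate p k a b s, a, b] \<in> S"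
      using inv by (auto simp: Inv_def preserves_iff_coordinatewise)
    then show ?case
      using coordinatewise_affine_op_translate[OF \<open>0 < p\<close>] nlistsE_length[OF s] by metis
  qed
qed

lemma cong_arith_progression_surj:
  fixes x d t m :: int
  assumes "coprime d m" "0 < m"
  obtains k :: nat where "[x + int k * d = t] (mod m)"
proof -
  obtain e where e: "[d * e = t - x] (mod m)"
    using cong_solve_dvd_int[of d m "t - x"] assms(1) by auto
  have "[x + int (nat (e mod m)) * d = x + e * d] (mod m)"
    using \<open>0 < m\<close> by (intro cong_add cong_mult) auto
  also have "[x + e * d = x + (t - x)] (mod m)"
    using e by (intro cong_add) (auto simp: mult.commute)
  finally have "[x + int (nat (e mod m)) * d = t] (mod m)" by simp
  then show ?thesis by (rule that)
qed

lemma translate_nth_surj: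
  assumes p: "prime p" and "a ! j < p" "b ! j < p" "a ! j \<noteq> b ! j" "j < length s" "t < p"
  obtains k where "translate p k a b s ! j = t"
proof -
  have "0 < p" using p by (rule prime_gt_0_nat)
  have "\<not> [b ! j = a ! j] (mod p)"
    using assms cong_less_modulus_unique_nat by metis
  then have "\<not> int p dvd int (b ! j) - int (a ! j)"
    by (metis cong_iff_dvd_diff cong_int_iff)
  then have "coprime (int (b ! j) - int (a ! j)) (int p)"
    using p by (metis coprime_commute prime_imp_coprime prime_nat_int_transfer)
  then obtain k
    where "[int (s ! j) + int k * (int (b ! j) - int (a ! j)) = int t] (mod int p)"
    using cong_arith_progression_surj \<open>0 < p\<close> by (metis of_nat_0_less_iff)
  then have "int (translate p k a b s ! j) = int t"
    using \<open>0 < p\<close> \<open>j < length s\<close> \<open>t < p\<close> by (simp add: int_nth_translate cong_def)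
  then show ?thesis using that by simp
qed

lemma affine_unconstrained_if_not_determined:
  assumes p: "prime p" and inv: "(N, S) \<in> Inv {0..<p} 3 (affine_op p)" and "j < N"
    and "\<not> determined n S j"
  shows "unconstrained {0..<p} n S j"
proof -
  obtain a b where ab: "a \<in> S" "b \<in> S" "take n a = take n b"
    and "a ! j \<noteq> b ! j"
    using \<open>\<not> determined n S j\<close> unfolding determined_def by blast
  have S: "S \<subseteq> nlists N {0..<p}" using inv by (simp add: Inv_def relations_def)
  have less: "u ! i < p" if "u \<in> S" "i < N" for u i
    using nlistsE_nth_in[OF subsetD[OF S \<open>u \<in> S\<close>] \<open>i < N\<close>] by simp
  show ?thesis
    unfolding unconstrained_def
  proof (intro ballI)
    fix s t assume "s \<in> S" "t \<in> {0..<p}"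
    have len: "length s = N" using subsetD[OF S \<open>s \<in> S\<close>] by (rule nlistsE_length)
    obtain k where "translate p k a b s ! j = t"
      using translate_nth_surj[OF p less less \<open>a ! j \<noteq> b ! j\<close>, of s t] ab(1,2) len \<open>j < N\<close>
        \<open>t \<in> {0..<p}\<close> by auto
    moreover have "translate p k a b s \<in> S"
      using translate_in_affine_relation[OF prime_gt_0_nat[OF p] inv] ab \<open>s \<in> S\<close> by blast
    moreover have "take n (translate p k a b s) = take n s"
    proof (rule nth_equalityI)
      fix i assume "i < length (take n (translate p k a b s))"
      then have "i < n" "i < N" using len by auto
      then have "a ! i = b ! i" using ab by (metis nth_take)
      then have "translate p k a b s ! i = s ! i"
        using nth_translate_equal less[OF \<open>s \<in> S\<close> \<open>i < N\<close>] \<open>i < N\<close> len by blast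
      then show "take n (translate p k a b s) ! i = take n s ! i"
        using \<open>i < n\<close> by simp
    qed simp
    ultimately show "\<exists>w \<in> S. take n w = take n s \<and> w ! j = t" by blast
  qed
qed

lemma affine_coordinate_dichotomy:
  assumes "prime p" "\<Delta> \<subseteq> Inv {0..<p} 3 (affine_op p)"
  shows "coordinate_dichotomy {0..<p} \<Delta>"
proof -
  have "affine_op p \<in> nlists 3 {0..<p} \<rightarrow> {0..<p}"
    using prime_gt_0_nat[OF assms(1)] by (simp add: affine_op_def nat_less_iff)
  then show ?thesis
    using affine_unconstrained_if_not_determined[OF assms(1)] solutions_in_Inv assms(2)
    unfolding coordinate_dichotomy_def by metis
qed

theorem theorem15:
  fixes p :: nat and D :: "nat set" and \<Gamma> :: "nat nrel set"
  assumes "prime p"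
    and "D = {0..<p}"
    and "\<Gamma> \<subseteq> relations D"
    and "pp_closure D \<Gamma> \<subseteq> Inv D 3 (affine_op p)"
  shows "uniquely_covered D (pp_closure D \<Gamma>)"
  unfolding uniquely_covered_def
proof (intro conjI allI impI)
  show "co_clone D (pp_closure D \<Gamma>)" using assms(3) by (auto simp: co_clone_def)
next
  fix \<Delta> assume "is_base D \<Delta> (pp_closure D \<Gamma>)"
  then have "\<Delta> \<subseteq> relations D" and closure: "pp_closure D \<Delta> = pp_closure D \<Gamma>"
    by (auto simp: is_base_def)
  then have "\<Delta> \<subseteq> Inv D 3 (affine_op p)" using subset_pp_closure assms(4) by blast
  then have "coordinate_dichotomy D \<Delta>" using affine_coordinate_dichotomy assms(1,2) by simp
  moreover have "D \<noteq> {}" using prime_gt_0_nat[OF assms(1)] assms(2) by simp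
  ultimately show "upp_closure D \<Delta> = pp_closure D \<Gamma>"
    using upp_closure_eq_pp_closure closure by metis
qed

end
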